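(* Let $(D,S)$ be a relational system on $A$ satisfying Condition 1 and let $R_1,\dots,R_M\subseteq A$ ($M\ge 2$) satisfy Condition 2 (both conditions are spelled out in the context). For every $k=1,\dots,M$, each $z\in R_k$ is assigned to $C_k$ by the conjoint assignment rule. Consequently, Conformity (the property that, for every $k=1,\dots,M$, each $z\in R_k$ is assigned to the class $C_k$) is not fulfilled by the separate rules (the descending rule alone and the ascending rule alone), but it is satisfied by the conjoint assignment procedure.
   Context: $A$ is the set of actions (all actions to be classified and all representative actions). $C=\{C_1,\dots,C_M\}$, $M\ge 2$, is a set of ordered classes, $C_M$ being the highest. Condition 1: $D$ and $S$ are binary relations on $A$ such that $D$ is transitive, $S$ is reflexive, and for all $x,y,z\in A$: $xDy\Rightarrow xSy$; ($xSy$ and $yDz$) $\Rightarrow xSz$; ($xDy$ and $ySz$) $\Rightarrow xSz$. ($S$ is also required to be "compatible with the order of the classes", i.e. $xSy$ gives an argument to believe that $x$ should be classified into a class equal to or higher than that of $y$; this is interpretive.) Condition 2: each class $C_k$ is characterized by a nonempty finite set $R_k\subseteq A$ of representative actions such that (a) for $k=1,\dots,M-1$ and every $w\in R_k$ there is $z\in R_{k+1}$ with $zDw$; (b) for $k=1,\dots,M-1$ and every $w\in R_{k+1}$ there is $z\in R_k$ with $wDz$; (c) for all $1\le k<h\le M$ and every $w\in R_h$ there is no $z\in R_k$ with $zSw$. Notation: $xSR_k$ iff there is $z\in R_k$ with $xSz$; $R_kSx$ iff there is $w\in R_k$ with $wSx$. Descending assignment rule: by convention $xSR_0$ holds for all $x$.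 Let $k$ be the largest element of $\{0,\dots,M\}$ with $xSR_k$. If $k=M$, assign $x$ to $C_M$; if $k=0$, assign $x$ to $C_1$; if $0<k<M$, assign $x$ to the range $C_k-C_{k+1}$ (both classes possible). Ascending assignment rule: by convention $R_{M+1}Sx$ holds for all $x$. Let $k$ be the smallest element of $\{1,\dots,M+1\}$ with $R_kSx$. If $k=1$, assign $x$ to $C_1$; if $k=M+1$, assign $x$ to $C_M$; if $1<k<M+1$, assign $x$ to the range $C_{k-1}-C_k$ (both classes possible). Assignment to a single class $C_k$ is regarded as assignment to the range $C_k-C_k$. Conjoint assignment rule: (a) if $x$ is assigned to $C_M$ by the descending rule and to $C_1$ by the ascending rule, the conjoint range is $C_1-C_M$; (b) if $x$ is assigned to the same range $C_h-C_{h+1}$ by both rules, the conjoint range is $C_h-C_{h+1}$; (c) if $x$ is assigned to $C_h-C_{k'}$ by the ascending rule and to $C_{k''}-C_{h'}$ by the descending rule, the conjoint range is $C_{k'}-C_{k''}$ if $k''\ge k'$, and $C_{k''}-C_{k'}$ if $k''<k'$. (Thus the two limits of the conjoint range are the lower limit of the descending range and the upper limit of the ascending range.) *)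

theory Defs
  imports Main
begin

text \<open>
  The classes \<open>C\<^sub>1, \<dots>, C\<^sub>M\<close> are represented by their indices \<open>1, \<dots>, M\<close>, ordered as natural
  numbers; the family of representative sets is only meaningful on these indices.
  The relations are predicates on the ambient type of which only the restriction to the
  set of actions \<open>A\<close> matters.
\<close>

definition condition1 :: "'a set \<Rightarrow> ('a \<Rightarrow> 'a \<Rightarrow> bool) \<Rightarrow> ('a \<Rightarrow> 'a \<Rightarrow> bool) \<Rightarrow> bool" where
  "condition1 A D S \<longleftrightarrow>
     transp_on A D \<and> reflp_on A S \<and>
     (\<forall>x\<in>A. \<forall>y\<in>A. D x y \<longrightarrow> S x y) \<and>
     (\<forall>x\<in>A. \<forall>y\<in>A. \<forall>z\<in>A. S x y \<and> D y z \<longrightarrow> S x z) \<and>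
     (\<forall>x\<in>A. \<forall>y\<in>A. \<forall>z\<in>A. D x y \<and> S y z \<longrightarrow> S x z)"

definition condition2 ::
  "'a set \<Rightarrow> ('a \<Rightarrow> 'a \<Rightarrow> bool) \<Rightarrow> ('a \<Rightarrow> 'a \<Rightarrow> bool) \<Rightarrow> nat \<Rightarrow> (nat \<Rightarrow> 'a set) \<Rightarrow> bool" where
  "condition2 A D S M R \<longleftrightarrow>
     (\<forall>k\<in>{1..M}. R k \<noteq> {} \<and> finite (R k) \<and> R k \<subseteq> A) \<and>
     (\<forall>k\<in>{1..<M}. \<forall>w\<in>R k. \<exists>z\<in>R (k + 1). D z w) \<and>
     (\<forall>k\<in>{1..<M}. \<forall>w\<in>R (k + 1). \<exists>z\<in>R k. D w z) \<and>
     (\<forall>k h. 1 \<le> k \<and> k < h \<and> h \<le> M \<longrightarrow> (\<forall>w\<in>R h. \<not> (\<exists>z\<in>R k. S z w)))"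

text \<open>
  The pair \<open>(i, j)\<close> is the range \<open>C\<^sub>i-C\<^sub>j\<close>; assignment to the single class \<open>C\<^sub>k\<close> is the range
  \<open>(k, k)\<close>.
\<close>

type_synonym class_range = "nat \<times> nat"

text \<open>
  \<open>x S R\<^sub>k\<close> for \<open>k \<in> {0..M}\<close> and \<open>R\<^sub>k S x\<close> for \<open>k \<in> {1..M+1}\<close>, including the conventions for
  \<open>R\<^sub>0\<close> and \<open>R\<^sub>M\<^sub>+\<^sub>1\<close>.
\<close>

definition act_S_set :: "('a \<Rightarrow> 'a \<Rightarrow> bool) \<Rightarrow> (nat \<Rightarrow> 'a set) \<Rightarrow> 'a \<Rightarrow> nat \<Rightarrow> bool" where
  "act_S_set S R x k \<longleftrightarrow> k = 0 \<or> (\<exists>z\<in>R k. S x z)"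

definition set_S_act :: "nat \<Rightarrow> ('a \<Rightarrow> 'a \<Rightarrow> bool) \<Rightarrow> (nat \<Rightarrow> 'a set) \<Rightarrow> nat \<Rightarrow> 'a \<Rightarrow> bool" where
  "set_S_act M S R k x \<longleftrightarrow> k = M + 1 \<or> (\<exists>w\<in>R k. S w x)"

definition descending_rule ::
  "nat \<Rightarrow> ('a \<Rightarrow> 'a \<Rightarrow> bool) \<Rightarrow> (nat \<Rightarrow> 'a set) \<Rightarrow> 'a \<Rightarrow> class_range" where
  "descending_rule M S R x =
     (let k = Max {k \<in> {0..M}. act_S_set S R x k}
      in if k = M then (M, M) else if k = 0 then (1, 1) else (k, k + 1))"

definition ascending_rule ::
  "nat \<Rightarrow> ('a \<Rightarrow> 'a \<Rightarrow> bool) \<Rightarrow> (nat \<Rightarrow> 'a set) \<Rightarrow> 'a \<Rightarrow> class_range" where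
  "ascending_rule M S R x =
     (let k = Min {k \<in> {1..M + 1}. set_S_act M S R k x}
      in if k = 1 then (1, 1) else if k = M + 1 then (M, M) else (k - 1, k))"

definition conjoint_rule ::
  "nat \<Rightarrow> ('a \<Rightarrow> 'a \<Rightarrow> bool) \<Rightarrow> (nat \<Rightarrow> 'a set) \<Rightarrow> 'a \<Rightarrow> class_range" where
  "conjoint_rule M S R x =
     (let asc = ascending_rule M S R x; desc = descending_rule M S R x;
          k' = snd asc; k'' = fst desc
      in if desc = (M, M) \<and> asc = (1, 1) then (1, M)
         else if asc = desc \<and> snd asc = fst asc + 1 then asc
         else if k'' \<ge> k' then (k', k'') else (k'', k'))"

definition conformity :: "nat \<Rightarrow> (nat \<Rightarrow> 'a set) \<Rightarrow> ('a \<Rightarrow> class_range) \<Rightarrow> bool" where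
  "conformity M R assign \<longleftrightarrow> (\<forall>k\<in>{1..M}. \<forall>z\<in>R k. assign z = (k, k))"

end

theory Submission
  imports Defs
begin

text \<open>
  Every \<open>z \<in> R k\<close> satisfies \<open>S z z\<close>, so both the largest \<open>h\<close> with \<open>z S R\<^sub>h\<close> and the smallest
  \<open>h\<close> with \<open>R\<^sub>h S z\<close> equal \<open>k\<close>, since condition 2 (c) excludes all larger, respectively smaller,
  indices. Hence the descending rule overshoots above for \<open>k < M\<close> and the ascending rule
  overshoots below for \<open>k > 1\<close>, while the conjoint rule keeps the two limits equal to \<open>k\<close>.
\<close>

lemma representative_S_self:
  assumes "condition1 A D S" "condition2 A D S M R" "k \<in> {1..M}" "z \<in> R k"
  shows "S z z"
  using assms unfolding condition1_def condition2_def by (meson reflp_onD subsetD)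

lemma not_S_higher_representative:
  assumes "condition2 A D S M R" "1 \<le> k" "k < h" "h \<le> M" "z \<in> R k" "w \<in> R h"
  shows "\<not> S z w"
  using assms unfolding condition2_def by blast

lemma descending_rule_representative:
  assumes "condition1 A D S" "condition2 A D S M R" "k \<in> {1..M}" "z \<in> R k"
  shows "descending_rule M S R z = (if k = M then (M, M) else (k, k + 1))"
proof -
  have "Max {h \<in> {0..M}. act_S_set S R z h} = k"
  proof (rule Max_eqI)
    fix h assume "h \<in> {h \<in> {0..M}. act_S_set S R z h}"
    \<comment> \<open>An index \<open>h > k\<close> is nonzero, so it is not in the set by the
      convention at 0 and some \<open>w \<in> R h\<close> has \<open>S z w\<close>.\<close>
    then show "h \<le> k"
      using not_S_higher_representative[OF assms(2), of k h z] assms(3,4)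
      by (force simp: act_S_set_def not_le)
  qed (use representative_S_self[OF assms] assms(3,4) in \<open>auto simp: act_S_set_def\<close>)
  then show ?thesis using assms(3) by (simp add: descending_rule_def)
qed

lemma ascending_rule_representative:
  assumes "condition1 A D S" "condition2 A D S M R" "k \<in> {1..M}" "z \<in> R k"
  shows "ascending_rule M S R z = (if k = 1 then (1, 1) else (k - 1, k))"
proof -
  have "Min {h \<in> {1..M + 1}. set_S_act M S R h z} = k"
  proof (rule Min_eqI)
    fix h assume "h \<in> {h \<in> {1..M + 1}. set_S_act M S R h z}"
    \<comment> \<open>An index \<open>h < k\<close> is at most \<open>M\<close>, so the convention
      at \<open>M + 1\<close> does not account for it.\<close>
    then show "k \<le> h"
      using not_S_higher_representative[OF assms(2), of h k _ z] assms(3,4)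
      by (force simp: set_S_act_def not_le)
  qed (use representative_S_self[OF assms] assms(3,4) in \<open>auto simp: set_S_act_def\<close>)
  then show ?thesis using assms(3) by (simp add: ascending_rule_def)
qed

text \<open>As \<open>M \<ge> 2\<close>, \<open>k\<close> is not both 1 and \<open>M\<close>. This
  rules out the first branch and makes the two ranges differ, so the last branch applies with both
  limits \<open>k\<close>.\<close>

lemma conjoint_rule_representative:
  assumes "M \<ge> 2" "condition1 A D S" "condition2 A D S M R" "k \<in> {1..M}" "z \<in> R k"
  shows "conjoint_rule M S R z = (k, k)"
  using assms(1,4) descending_rule_representative[OF assms(2-)]
    ascending_rule_representative[OF assms(2-)]
  by (auto simp: conjoint_rule_def)

theorem mainTheorem3:
  fixes A :: "'a set" and D S :: "'a \<Rightarrow> 'a \<Rightarrow> bool"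
    and M :: nat and R :: "nat \<Rightarrow> 'a set"
  assumes "M \<ge> 2"
    and "condition1 A D S"
    and "condition2 A D S M R"
  shows "(\<forall>k\<in>{1..M}. \<forall>z\<in>R k. conjoint_rule M S R z = (k, k)) \<and>
    \<not> conformity M R (descending_rule M S R) \<and>
    \<not> conformity M R (ascending_rule M S R) \<and>
    conformity M R (conjoint_rule M S R)"
proof -
  have conj: "\<forall>k\<in>{1..M}. \<forall>z\<in>R k. conjoint_rule M S R z = (k, k)"
    using conjoint_rule_representative[OF assms] by blast
  have bounds: "1 \<in> {1..M}" "M \<in> {1..M}" using assms(1) by auto
  \<comment> \<open>Since \<open>1 < M\<close>, \<open>a\<close> is below the top class and refutes
    the descending rule, while \<open>b\<close> is above the bottom class and refutes the ascending
    one.\<close>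
  then obtain a b where ab: "a \<in> R 1" "b \<in> R M"
    using assms(3) unfolding condition2_def by (meson ex_in_conv)
  have "descending_rule M S R a \<noteq> (1, 1)"
    using descending_rule_representative[OF assms(2,3) bounds(1) ab(1)] assms(1) by simp
  moreover have "ascending_rule M S R b \<noteq> (M, M)"
    using ascending_rule_representative[OF assms(2,3) bounds(2) ab(2)] assms(1) by simp
  ultimately show ?thesis
    using conj bounds ab unfolding conformity_def by blast
qed

end
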